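(* Let $m\ge 2$ be an integer and $\beta_m=2-\frac{2}{m}$. The polynomials $\{T_n^{\beta_m,0}\}_{n=0,1,\dots}=\{T_{mn}\}_{n=0,1,\dots}$ (that is, $T_n^{\beta_m,0}=T_{mn}$ on $[-1,1]$ for every integer $n\ge0$) are orthogonal on $\Omega_{\beta_m,0}=[-\cos(\beta_m\pi/2),1]$ with respect to the weight function $$w^{\beta_m,0}(x)=\frac{m}{\sqrt{1-x^2}},\quad x\in\Omega_{\beta_m,0}.$$
   Context: Let $\Omega=[-1,1]$. $T_k(x)=\cos(k\arccos x)$, $x\in\Omega$, denotes the classical Chebyshev polynomial of the first kind of degree $k$. For $\beta,\gamma\in[0,2)$ with $\beta+\gamma<2$ and an integer $n\ge 0$, the $(\beta,\gamma)$-Chebyshev function is $$T_n^{\beta,\gamma}(x)=\cos\Big(\frac{2n}{2-\beta-\gamma}\Big(\arccos x-\frac{\gamma\pi}{2}\Big)\Big),\quad x\in\Omega,$$ and $\Omega_{\beta,\gamma}=[-\cos(\beta\pi/2),\cos(\gamma\pi/2)]$. Orthogonality of a family $(f_n)$ on an interval $I$ with respect to a weight $w$ means $\int_I f_r f_s\, w\,\mathrm{d}x=0$ for all $r\ne s$. *)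

theory Defs
  imports "HOL-Analysis.Analysis" "HOL-Computational_Algebra.Polynomial"
begin

definition cheb_T :: "nat \<Rightarrow> real \<Rightarrow> real" where
  "cheb_T k x = cos (real k * arccos x)"

(* Meaningful for \<beta>, \<gamma> in [0,2) with \<beta> + \<gamma> < 2, and for x in [-1,1],
   outside of which arccos is unspecified. *)
definition cheb_fun :: "real \<Rightarrow> real \<Rightarrow> nat \<Rightarrow> real \<Rightarrow> real" where
  "cheb_fun \<beta> \<gamma> n x =
     cos (2 * real n / (2 - \<beta> - \<gamma>) * (arccos x - \<gamma> * pi / 2))"

definition Omega :: "real \<Rightarrow> real \<Rightarrow> real set" where
  "Omega \<beta> \<gamma> = {- cos (\<beta> * pi / 2) .. cos (\<gamma> * pi / 2)}"

(* Integrability is required explicitly because the Lebesgue integral of a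
   non-integrable function is 0 by convention. *)
definition orthogonal_on ::
  "real set \<Rightarrow> (real \<Rightarrow> real) \<Rightarrow> (nat \<Rightarrow> real \<Rightarrow> real) \<Rightarrow> bool" where
  "orthogonal_on I w f \<longleftrightarrow>
     (\<forall>r s. r \<noteq> s \<longrightarrow>
        set_integrable lborel I (\<lambda>x. f r x * f s x * w x) \<and>
        (LINT x:I|lborel. f r x * f s x * w x) = 0)"

end

theory Submission
  imports Defs
begin

text \<open>
  Since \<open>2 - \<beta> = 2 / m\<close>, the interval is \<open>[cos (\<pi> / m), 1]\<close>, and \<open>\<theta> = arccos x\<close> turns the
  inner product into \<open>m * \<integral> cos (m r \<theta>) cos (m s \<theta>) d\<theta>\<close> over \<open>[0, \<pi> / m]\<close>. It vanishes
  because the antiderivative is a combination of \<open>sin (m (r \<plusminus> s) \<theta>)\<close>.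
\<close>

text \<open>Adding the cosine formulas for \<open>(k + 1) * t + t\<close> and
  \<open>(k + 1) * t - t\<close> cancels the sine terms.\<close>

lemma cheb_T_Suc_Suc:
  assumes "x \<in> {-1..1}"
  shows "cheb_T (Suc (Suc k)) x = 2 * x * cheb_T (Suc k) x - cheb_T k x"
proof -
  define t where "t = arccos x"
  have x: "cos t = x"
    using assms by (simp add: t_def)
  have "real (Suc (Suc k)) * t = real (Suc k) * t + t" "real k * t = real (Suc k) * t - t"
    by (simp_all add: algebra_simps)
  then show ?thesis
    unfolding cheb_T_def t_def[symmetric] by (simp only: cos_add cos_diff x) simp
qed

text \<open>Justifies calling these functions polynomials. In the recurrence
  \<open>2 * x * q - p\<close> the first term has degree \<open>k + 2\<close> and \<open>p\<close>
  only degree \<open>k\<close>, so the leading term survives and the degree is exact.\<close>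

lemma cheb_T_poly:
  "\<exists>p :: real poly. degree p = k \<and> (\<forall>x\<in>{-1..1}. cheb_T k x = poly p x)"
proof (induction k rule: induct_nat_012)
  case 0
  show ?case
    by (rule exI[of _ 1]) (simp add: cheb_T_def)
next
  case 1
  show ?case
    by (rule exI[of _ "[:0, 1:]"]) (simp add: cheb_T_def)
next
  case (ge2 k)
  then obtain p q :: "real poly"
    where p: "degree p = k" "\<forall>x\<in>{-1..1}. cheb_T k x = poly p x"
      and q: "degree q = Suc k" "\<forall>x\<in>{-1..1}. cheb_T (Suc k) x = poly q x"
    by auto
  have "q \<noteq> 0"
    using q(1) by auto
  then have deg: "degree (pCons 0 (smult 2 q)) = Suc (Suc k)"
    using q(1) by simp
  then have "degree (pCons 0 (smult 2 q) + - p) = Suc (Suc k)"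
    using p(1) by (subst degree_add_eq_left) simp_all
  moreover have "cheb_T (Suc (Suc k)) x = poly (pCons 0 (smult 2 q) + - p) x" if "x \<in> {-1..1}" for x
    using p(2) q(2) that by (simp add: cheb_T_Suc_Suc)
  ultimately show ?case
    by blast
qed

text \<open>By the chain rule \<open>- G (arccos x)\<close> is an antiderivative. Since
  \<open>arccos\<close> is not differentiable at the endpoints 1 and -1, the fundamental theorem is
  used in the form that asks for continuity on the closed interval and a derivative only
  inside.\<close>

lemma has_integral_arccos_substitution:
  fixes a :: real
  assumes "a \<in> {-1..1}"
    and G: "\<And>t. (G has_real_derivative g t) (at t)"
  shows "((\<lambda>x. g (arccos x) / sqrt (1 - x\<^sup>2)) has_integral (G (arccos a) - G 0)) {a..1}"
proof -
  have "((\<lambda>x. g (arccos x) / sqrt (1 - x\<^sup>2)) has_integral (- G (arccos 1) - - G (arccos a))) {a..1}"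
  proof (rule fundamental_theorem_of_calculus_interior)
    have "continuous_on UNIV G"
      by (rule DERIV_continuous_on) (rule has_field_derivative_at_within[OF G])
    moreover have "continuous_on {a..1} arccos"
      using assms(1) by (intro continuous_intros) auto
    ultimately show "continuous_on {a..1} (\<lambda>x. - G (arccos x))"
      by (intro continuous_on_minus) (rule continuous_on_compose2[of UNIV G], auto)
  next
    fix x assume "x \<in> {a<..<1}"
    then have x: "-1 < x" "x < 1"
      using assms(1) by auto
    have "((\<lambda>x. G (arccos x)) has_real_derivative g (arccos x) * inverse (- sqrt (1 - x\<^sup>2))) (at x)"
      by (rule DERIV_chain2[OF G DERIV_arccos[OF x]])
    from DERIV_minus[OF this]
    show "((\<lambda>x. - G (arccos x)) has_vector_derivative g (arccos x) / sqrt (1 - x\<^sup>2)) (at x)"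
      by (simp add: has_real_derivative_iff_has_vector_derivative divide_inverse)
  qed (use assms(1) in auto)
  then show ?thesis
    by simp
qed

text \<open>The weight is unbounded near 1, so continuity on a compact interval does not give
  integrability. The weight alone is handled first, and the bounded factor
  \<open>g (arccos x)\<close> is then added by domination.\<close>

lemma set_integrable_arccos_weight:
  fixes a :: real
  assumes a: "a \<in> {-1..1}" and g: "continuous_on {0..pi} g"
  shows "set_integrable lborel {a..1} (\<lambda>x. g (arccos x) / sqrt (1 - x\<^sup>2))"
proof -
  \<comment> \<open>The substitution with \<open>G\<close> the identity and \<open>g\<close>
    constantly 1. Nonnegativity then upgrades gauge integrability to absolute integrability.\<close>
  have "((\<lambda>x. 1 / sqrt (1 - x\<^sup>2)) has_integral (arccos a - 0)) {a..1}"
    by (rule has_integral_arccos_substitution[OF a]) (rule DERIV_ident)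
  moreover have "0 \<le> 1 / sqrt (1 - x\<^sup>2)" if "x \<in> {a..1}" for x
    using that a by (auto simp: abs_square_le_1)
  ultimately have "(\<lambda>x. 1 / sqrt (1 - x\<^sup>2)) absolutely_integrable_on {a..1}"
    by (intro nonnegative_absolutely_integrable_1) (auto simp: integrable_on_def)
  \<comment> \<open>Absolute integrability refers to the completed measure; Borel measurability of
    the weight brings it back to \<open>lborel\<close>.\<close>
  then have w: "set_integrable lborel {a..1} (\<lambda>x. 1 / sqrt (1 - x\<^sup>2))"
    unfolding set_integrable_def by (subst (asm) integrable_completion) simp_all
  obtain B where B: "\<And>t. t \<in> {0..pi} \<Longrightarrow> \<bar>g t\<bar> \<le> B"
    using compact_imp_bounded[OF compact_continuous_image[OF g compact_Icc]]
    by (fastforce simp: bounded_iff)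
  have "continuous_on {a..1} (\<lambda>x. g (arccos x))"
    using a by (intro continuous_on_compose2[OF g] continuous_on_arccos continuous_on_id)
      (auto simp: arccos_lbound arccos_ubound)
  \<comment> \<open>The indicator stays attached because \<open>arccos\<close> is unspecified
    outside [-1,1].\<close>
  then have [measurable]: "(\<lambda>x. indicator {a..1} x *\<^sub>R g (arccos x)) \<in> borel_measurable borel"
    by (intro borel_measurable_continuous_on_indicator) auto
  have "(\<lambda>x. (indicator {a..1} x *\<^sub>R g (arccos x)) * (1 / sqrt (1 - x\<^sup>2))) \<in> borel_measurable borel"
    by measurable
  then have meas: "set_borel_measurable lborel {a..1} (\<lambda>x. g (arccos x) / sqrt (1 - x\<^sup>2))"
    by (simp add: set_borel_measurable_def)
  have "set_integrable lborel {a..1} (\<lambda>x. B * (1 / sqrt (1 - x\<^sup>2)))"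
    using w by (rule set_integrable_mult_right)
  then show ?thesis
  proof (rule set_integrable_bound[OF _ meas], intro AE_I2 impI)
    fix x assume x: "x \<in> {a..1}"
    then have "\<bar>g (arccos x)\<bar> \<le> B"
      using a by (intro B) (auto simp: arccos_lbound arccos_ubound)
    then have "norm (g (arccos x) / sqrt (1 - x\<^sup>2)) \<le> B * \<bar>1 / sqrt (1 - x\<^sup>2)\<bar>"
      by (simp add: divide_right_mono)
    also have "\<dots> \<le> norm (B * (1 / sqrt (1 - x\<^sup>2)))"
      by (simp add: abs_mult divide_right_mono)
    finally show "norm (g (arccos x) / sqrt (1 - x\<^sup>2)) \<le> norm (B * (1 / sqrt (1 - x\<^sup>2)))" .
  qed
qed

lemma set_lebesgue_integral_arccos_substitution:
  fixes a :: real
  assumes a: "a \<in> {-1..1}"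
    and "\<And>t. (G has_real_derivative g t) (at t)" "continuous_on {0..pi} g"
  shows "(LINT x:{a..1}|lborel. g (arccos x) / sqrt (1 - x\<^sup>2)) = G (arccos a) - G 0"
  using set_borel_integral_eq_integral(2)[OF set_integrable_arccos_weight[OF a assms(3)]]
    integral_unique[OF has_integral_arccos_substitution[OF a assms(2)]]
  by simp

text \<open>Product-to-sum formula, integrated termwise; the assumptions keep both denominators
  nonzero.\<close>

lemma DERIV_cos_mult_cos:
  fixes a b t :: real
  assumes "a \<noteq> b" "a + b \<noteq> 0"
  shows "((\<lambda>t. sin ((a - b) * t) / (2 * (a - b)) + sin ((a + b) * t) / (2 * (a + b)))
    has_real_derivative cos (a * t) * cos (b * t)) (at t)"
proof -
  have "((\<lambda>t. sin ((a - b) * t) / (2 * (a - b)) + sin ((a + b) * t) / (2 * (a + b)))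
    has_real_derivative cos ((a - b) * t) / 2 + cos ((a + b) * t) / 2) (at t)"
    using assms by (auto intro!: derivative_eq_intros simp: divide_simps) (simp_all add: algebra_simps)
  moreover have "cos ((a - b) * t) / 2 + cos ((a + b) * t) / 2 = cos (a * t) * cos (b * t)"
    by (simp add: cos_times_cos left_diff_distrib distrib_right add_divide_distrib)
  ultimately show ?thesis
    by simp
qed

theorem corollary2:
  fixes m :: nat and \<beta> :: real
  assumes "m \<ge> 2"
    and "\<beta> = 2 - 2 / real m"
  shows "(\<forall>n. \<forall>x\<in>{-1..1}. cheb_fun \<beta> 0 n x = cheb_T (m * n) x)
    \<and> (\<forall>n. \<exists>p :: real poly. degree p = m * n \<and> (\<forall>x\<in>{-1..1}. cheb_fun \<beta> 0 n x = poly p x))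
    \<and> Omega \<beta> 0 = {- cos (\<beta> * pi / 2) .. 1}
    \<and> orthogonal_on (Omega \<beta> 0) (\<lambda>x. real m / sqrt (1 - x\<^sup>2)) (cheb_fun \<beta> 0)"
proof -
  have m: "real m > 0"
    using assms(1) by simp
  \<comment> \<open>The frequency factor \<open>2 / (2 - \<beta>)\<close> equals
    \<open>m\<close>.\<close>
  have fun_eq: "cheb_fun \<beta> 0 n x = cheb_T (m * n) x" for n x
    using m by (simp add: cheb_fun_def cheb_T_def assms(2) field_simps)
  have "\<beta> * pi / 2 = pi - pi / real m"
    using m by (simp add: assms(2) field_simps)
  then have Omega: "Omega \<beta> 0 = {cos (pi / real m)..1}"
    by (simp only: Omega_def cos_pi_minus) simp
  have "orthogonal_on (Omega \<beta> 0) (\<lambda>x. real m / sqrt (1 - x\<^sup>2)) (cheb_fun \<beta> 0)"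
    unfolding orthogonal_on_def Omega
  proof (intro allI impI)
    fix r s :: nat
    assume "r \<noteq> s"
    define a b where "a = real m * real r" and "b = real m * real s"
    define G where
      "G = (\<lambda>t. sin ((a - b) * t) / (2 * (a - b)) + sin ((a + b) * t) / (2 * (a + b)))"
    define g where "g = (\<lambda>t. real m * (cos (a * t) * cos (b * t)))"
    have ne: "a \<noteq> b" "a + b \<noteq> 0"
      using m \<open>r \<noteq> s\<close> unfolding a_def b_def distrib_left[symmetric] by auto
    have G: "((\<lambda>t. real m * G t) has_real_derivative g t) (at t)" for t
      unfolding G_def g_def by (intro DERIV_cmult DERIV_cos_mult_cos ne)
    have g: "continuous_on {0..pi} g"
      unfolding g_def by (intro continuous_intros)
    have eq: "cheb_fun \<beta> 0 r x * cheb_fun \<beta> 0 s x * (real m / sqrt (1 - x\<^sup>2))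
        = g (arccos x) / sqrt (1 - x\<^sup>2)" for x
      by (simp add: fun_eq cheb_T_def g_def a_def b_def)
    have le: "pi / real m \<le> pi"
      using assms(1) by (simp add: field_simps)
    \<comment> \<open>At the left endpoint of the interval the angle is \<open>pi / m\<close>, which
      turns both frequencies into integer multiples of \<open>pi\<close>, so both sines
      vanish.\<close>
    have "(a - b) * (pi / real m) = pi * of_int (int r - int s)"
      "(a + b) * (pi / real m) = pi * of_int (int r + int s)"
      using m by (simp_all add: a_def b_def field_simps)
    then have "sin ((a - b) * (pi / real m)) = 0" "sin ((a + b) * (pi / real m)) = 0"
      by (simp_all only: sin_npi_int)
    then have "G (pi / real m) = 0"
      by (simp add: G_def)
    moreover have "G 0 = 0"
      by (simp add: G_def)
    moreover have "arccos (cos (pi / real m)) = pi / real m"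
      using le by (intro arccos_cos) auto
    ultimately have "(LINT x:{cos (pi / real m)..1}|lborel. g (arccos x) / sqrt (1 - x\<^sup>2)) = 0"
      using set_lebesgue_integral_arccos_substitution[OF _ G g, of "cos (pi / real m)"] by simp
    then show "set_integrable lborel {cos (pi / real m)..1}
          (\<lambda>x. cheb_fun \<beta> 0 r x * cheb_fun \<beta> 0 s x * (real m / sqrt (1 - x\<^sup>2)))
        \<and> (LINT x:{cos (pi / real m)..1}|lborel.
            cheb_fun \<beta> 0 r x * cheb_fun \<beta> 0 s x * (real m / sqrt (1 - x\<^sup>2))) = 0"
      unfolding eq using set_integrable_arccos_weight[OF _ g, of "cos (pi / real m)"] by simp
  qed
  moreover have "Omega \<beta> 0 = {- cos (\<beta> * pi / 2) .. 1}"
    by (simp add: Omega_def)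
  ultimately show ?thesis
    using cheb_T_poly by (simp add: fun_eq)
qed

end
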